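(* For every $n$, every Erdős matrix $A\in\mathcal{B}_n$ has only rational entries.
   Context: $\mathcal{B}_n$ denotes the set of $n\times n$ bistochastic matrices: real matrices with non-negative entries whose rows and columns each sum to $1$. $\|A\|_{\mathrm{F}}^2=\sum_{i,j=1}^{n}A_{i,j}^2$ is the squared Frobenius norm. The maximal trace of $A$ is $\mathrm{maxTrace}(A)=\max_{\sigma\in S_n}\sum_{i=1}^{n}A_{i,\sigma(i)}$, where $S_n$ is the set of permutations of $\{1,\ldots,n\}$. A matrix $A\in\mathcal{B}_n$ is an Erdős matrix if $\|A\|_{\mathrm{F}}^2=\mathrm{maxTrace}(A)$. *)

theory Defs
  imports "HOL-Analysis.Analysis" "HOL-Combinatorics.Permutations"
begin

text \<open>
  The index set \<open>{1..n}\<close> is rendered by a finite type \<open>'n\<close>, with \<open>n = CARD('n)\<close>.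
  The constants below are polymorphic in \<open>'n\<close>, so statements range over all \<open>n \<ge> 1\<close>.
\<close>

definition bistochastic :: "(real ^ 'n ^ 'n) set" where
  "bistochastic = {A. (\<forall>i j. 0 \<le> A $ i $ j) \<and>
     (\<forall>i. (\<Sum>j\<in>UNIV. A $ i $ j) = 1) \<and> (\<forall>j. (\<Sum>i\<in>UNIV. A $ i $ j) = 1)}"

definition frobenius_sq :: "real ^ 'n ^ 'n \<Rightarrow> real" where
  "frobenius_sq A = (\<Sum>i\<in>UNIV. \<Sum>j\<in>UNIV. (A $ i $ j)\<^sup>2)"

definition maxTrace :: "real ^ 'n ^ 'n \<Rightarrow> real" where
  "maxTrace A = Max {\<Sum>i\<in>UNIV. A $ i $ \<sigma> i | \<sigma>. \<sigma> permutes (UNIV :: 'n set)}"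

definition Erdos_matrix :: "real ^ 'n ^ 'n \<Rightarrow> bool" where
  "Erdos_matrix A \<longleftrightarrow> A \<in> bistochastic \<and> frobenius_sq A = maxTrace A"

end

theory Submission
  imports Defs
begin

text \<open>
  Write \<open>\<langle>X, Y\<rangle>\<close> for the entrywise inner product. Weighing \<open>A\<close> against a permutation matrix gives
  at most \<open>maxTrace A\<close>, so by Birkhoff's decomposition \<open>\<langle>A, B\<rangle> \<le> maxTrace A\<close> for every bistochastic
  \<open>B\<close>. For an Erdos matrix the bound is attained at \<open>B = A\<close>. Hence \<open>\<langle>A, X\<rangle> = 0\<close> for every direction
  \<open>X\<close> in which one can move from \<open>A\<close> both ways without leaving the bistochastic matrices: these are
  the matrices with vanishing line sums that are supported where \<open>A\<close> is
  (\<open>Erdos_matrix_orthogonal\<close>).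

  The directions form a space defined over \<open>\<rat>\<close>, and \<open>A\<close> is the point of a rational affine space
  closest to the origin, which forces it to be rational. The following argument yields this
  without choosing bases of matrices. If some entry \<open>a\<close> of \<open>A\<close> is irrational, then \<open>1\<close> and \<open>a\<close> are
  linearly independent over \<open>\<rat>\<close>, so there is a \<open>\<rat>\<close>-linear \<open>g : \<real> \<rightarrow> \<rat>\<close> with \<open>g 1 = 0\<close> and
  \<open>g a = 1\<close>. Apply \<open>g\<close> to every entry of \<open>A\<close>. The resulting matrix \<open>g A\<close> is supported where \<open>A\<close> is,
  and its line sums are \<open>g 1 = 0\<close>, so \<open>\<langle>A, g A\<rangle> = 0\<close>. As \<open>g A\<close> is rational, applying \<open>g\<close> to this
  equation gives \<open>\<langle>g A, g A\<rangle> = 0\<close>. Therefore \<open>g A = 0\<close>, contradicting \<open>g a = 1\<close>.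
\<close>

section \<open>Birkhoff's theorem for linear functionals\<close>

text \<open>
  Hall's marriage theorem, by Rado's argument: as long as some \<open>A k\<close> has two elements, one of them
  can be deleted without violating Hall's condition, and once all sets are singletons the
  condition says that they are distinct. If deleting \<open>x\<close> were obstructed by \<open>J\<close> and deleting \<open>y\<close>
  by \<open>K\<close>, the neighbourhoods of \<open>J \<union> K\<close> and \<open>(J \<inter> K) - {k}\<close> would together be too small.
\<close>

lemma hall_marriage:
  fixes A :: "'a \<Rightarrow> 'b set"
  assumes "finite I" and "\<And>i. i \<in> I \<Longrightarrow> finite (A i)"
    and "\<And>J. J \<subseteq> I \<Longrightarrow> card J \<le> card (\<Union>i\<in>J. A i)"
  shows "\<exists>f. inj_on f I \<and> (\<forall>i\<in>I. f i \<in> A i)"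
  using assms(2,3)
proof (induction "\<Sum>i\<in>I. card (A i)" arbitrary: A rule: less_induct)
  case less
  note fin = less.prems(1) and hall = less.prems(2)
  show ?case
  proof (cases "\<forall>i\<in>I. card (A i) \<le> 1")
    case True
    have "\<exists>x. A i = {x}" if "i \<in> I" for i
      using hall[of "{i}"] True that by (auto simp: card_1_singleton_iff[symmetric] le_antisym)
    then obtain f where f: "\<And>i. i \<in> I \<Longrightarrow> A i = {f i}" by metis
    have "inj_on f I"
    proof (rule inj_onI, rule ccontr)
      fix i j assume "i \<in> I" "j \<in> I" "f i = f j" "i \<noteq> j"
      then show False using hall[of "{i, j}"] f[of i] f[of j] by auto
    qed
    then show ?thesis using f by blast
  next
    case False
    then obtain k where k: "k \<in> I" "\<not> card (A k) \<le> 1" by blast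
    then obtain x y where xy: "x \<in> A k" "y \<in> A k" "x \<noteq> y"
      using fin[OF k(1)] by (metis card_le_Suc0_iff_eq One_nat_def)
    define D where "D z = A(k := A k - {z})" for z
    have shrink: "\<exists>f. inj_on f I \<and> (\<forall>i\<in>I. f i \<in> A i)"
      if z: "z \<in> A k" and hz: "\<And>J. J \<subseteq> I \<Longrightarrow> card J \<le> card (\<Union>i\<in>J. D z i)" for z
    proof -
      have sub: "D z i \<subseteq> A i" for i by (auto simp: D_def)
      have "card (D z k) < card (A k)"
        using z card_Diff1_less[OF fin[OF k(1)]] by (simp only: D_def fun_upd_same)
      then have "(\<Sum>i\<in>I. card (D z i)) < (\<Sum>i\<in>I. card (A i))"
        using assms(1) k(1) fin sub by (intro sum_strict_mono_ex1) (auto intro: card_mono)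
      then have "\<exists>f. inj_on f I \<and> (\<forall>i\<in>I. f i \<in> D z i)"
        using less.hyps[of "D z"] fin sub hz by (meson finite_subset)
      then show ?thesis using sub by blast
    qed
    have obstruction: "\<exists>J\<subseteq>I. k \<in> J \<and> card (\<Union>i\<in>J. D z i) < card J"
      if violated: "\<not> (\<forall>J\<subseteq>I. card J \<le> card (\<Union>i\<in>J. D z i))" for z
    proof -
      obtain J where J: "J \<subseteq> I" "card (\<Union>i\<in>J. D z i) < card J" using violated by (auto simp: not_le)
      have "k \<in> J"
      proof (rule ccontr)
        assume "k \<notin> J"
        then have "(\<Union>i\<in>J. D z i) = (\<Union>i\<in>J. A i)" by (auto simp: D_def split: if_splits)
        then show False using hall[OF J(1)] J(2) by simp
      qed
      then show ?thesis using J by blast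
    qed
    show ?thesis
    proof (rule ccontr)
      assume "\<not> ?thesis"
      then have no_shrink: "\<not> (\<forall>J\<subseteq>I. card J \<le> card (\<Union>i\<in>J. D z i))" if "z \<in> A k" for z
        using shrink[OF that] by metis
      obtain J where J: "J \<subseteq> I" "k \<in> J" "card (\<Union>i\<in>J. D x i) < card J"
        using obstruction[OF no_shrink[OF xy(1)]] by blast
      obtain K where K: "K \<subseteq> I" "k \<in> K" "card (\<Union>i\<in>K. D y i) < card K"
        using obstruction[OF no_shrink[OF xy(2)]] by blast
      let ?P = "\<Union>i\<in>J. D x i" and ?Q = "\<Union>i\<in>K. D y i"
      have finJK: "finite J" "finite K" using J(1) K(1) assms(1) finite_subset by blast+
      have finD: "finite (D z i)" if "i \<in> I" for z i using fin that by (auto simp: D_def)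
      have finPQ: "finite ?P" "finite ?Q"
        using finJK finD J(1) K(1) by (simp_all add: subset_iff)
      have "A k \<subseteq> D x k \<union> D y k" using xy by (auto simp: D_def)
      then have "(\<Union>i\<in>J \<union> K. A i) \<subseteq> ?P \<union> ?Q"
        using J(2) K(2) by (auto simp: D_def split: if_splits)
      then have "card (\<Union>i\<in>J \<union> K. A i) \<le> card (?P \<union> ?Q)"
        using finPQ by (intro card_mono) auto
      then have "card (J \<union> K) \<le> card (?P \<union> ?Q)"
        using hall[of "J \<union> K"] J(1) K(1) by simp
      moreover have "(\<Union>i\<in>J \<inter> K - {k}. A i) \<subseteq> ?P \<inter> ?Q"
        by (auto simp: D_def)
      then have "card (\<Union>i\<in>J \<inter> K - {k}. A i) \<le> card (?P \<inter> ?Q)"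
        using finPQ by (intro card_mono) auto
      then have "card (J \<inter> K - {k}) \<le> card (?P \<inter> ?Q)"
        using hall[of "J \<inter> K - {k}"] J(1) by fastforce
      then have "card (J \<inter> K) \<le> card (?P \<inter> ?Q) + 1"
        using J(2) K(2) finJK by (simp add: card_Diff_singleton)
      moreover have "card ?P + card ?Q = card (?P \<union> ?Q) + card (?P \<inter> ?Q)"
        using finPQ by (rule card_Un_Int)
      moreover have "card J + card K = card (J \<union> K) + card (J \<inter> K)"
        using finJK by (rule card_Un_Int)
      ultimately show False using J(3) K(3) by linarith
    qed
  qed
qed

text \<open>
  Hall's condition holds for the supports of the rows: the rows in \<open>J\<close> carry total mass
  \<open>s * card J\<close>, all of it in the columns they meet, and each column holds only \<open>s\<close>.
\<close>

lemma permutation_in_support: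
  fixes B :: "real ^ 'n ^ 'n"
  assumes nonneg: "\<And>i j. 0 \<le> B $ i $ j" and "0 < s"
    and rows: "\<And>i. (\<Sum>j\<in>UNIV. B $ i $ j) = s" and cols: "\<And>j. (\<Sum>i\<in>UNIV. B $ i $ j) = s"
  obtains \<sigma> where "\<sigma> permutes UNIV" "\<And>i. 0 < B $ i $ \<sigma> i"
proof -
  have "card J \<le> card (\<Union>i\<in>J. {j. 0 < B $ i $ j})" for J :: "'n set"
  proof -
    let ?N = "\<Union>i\<in>J. {j. 0 < B $ i $ j}"
    have "real (card J) * s = (\<Sum>i\<in>J. \<Sum>j\<in>UNIV. B $ i $ j)" by (simp add: rows)
    also have "\<dots> = (\<Sum>i\<in>J. \<Sum>j\<in>?N. B $ i $ j)"
      by (intro sum.cong refl sum.mono_neutral_right)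
        (use nonneg in \<open>auto simp: not_less intro: antisym\<close>)
    also have "\<dots> = (\<Sum>j\<in>?N. \<Sum>i\<in>J. B $ i $ j)" by (rule sum.swap)
    also have "\<dots> \<le> (\<Sum>j\<in>?N. \<Sum>i\<in>UNIV. B $ i $ j)"
      by (intro sum_mono sum_mono2) (auto simp: nonneg)
    also have "\<dots> = real (card ?N) * s" by (simp add: cols)
    finally show ?thesis using \<open>0 < s\<close> by simp
  qed
  then obtain f where f: "inj f" "\<And>i. 0 < B $ i $ f i"
    using hall_marriage[of UNIV "\<lambda>i. {j. 0 < B $ i $ j}"] by auto
  then have "f permutes UNIV"
    by (intro bij_imp_permutes) (simp_all add: finite_UNIV_inj_surj bij_def)
  then show ?thesis using f(2) that by blast
qed

lemma permutation_trace_le_maxTrace: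
  fixes C :: "real ^ 'n ^ 'n"
  assumes "\<sigma> permutes UNIV"
  shows "(\<Sum>i\<in>UNIV. C $ i $ \<sigma> i) \<le> maxTrace C"
  unfolding maxTrace_def using assms
  by (intro Max_ge) (auto simp: finite_permutations Setcompr_eq_image)

text \<open>
  Birkhoff's decomposition, phrased for the linear functional \<open>C\<close>. Subtracting from \<open>B\<close> the
  largest admissible multiple of a permutation matrix supported in \<open>B\<close> kills an entry, which
  drives the induction; the common line sum \<open>s\<close> must be allowed to vary because it drops as well.
\<close>

lemma inner_le_maxTrace:
  fixes B C :: "real ^ 'n ^ 'n"
  assumes "\<And>i j. 0 \<le> B $ i $ j"
    and "\<And>i. (\<Sum>j\<in>UNIV. B $ i $ j) = s" and "\<And>j. (\<Sum>i\<in>UNIV. B $ i $ j) = s"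
  shows "(\<Sum>i\<in>UNIV. \<Sum>j\<in>UNIV. C $ i $ j * B $ i $ j) \<le> s * maxTrace C"
  using assms
proof (induction "card {(i, j). 0 < B $ i $ j}" arbitrary: B s rule: less_induct)
  case less
  note nonneg = less.prems(1) and rows = less.prems(2) and cols = less.prems(3)
  have "0 \<le> s" using rows[of undefined] nonneg by (metis sum_nonneg)
  show ?case
  proof (cases "s = 0")
    case True
    have "B $ i $ j = 0" for i j
      using rows[of i] True nonneg by (simp add: sum_nonneg_eq_0_iff)
    then show ?thesis using True by simp
  next
    case False
    then have "0 < s" using \<open>0 \<le> s\<close> by simp
    obtain \<sigma> where \<sigma>: "\<sigma> permutes UNIV" "\<And>i. 0 < B $ i $ \<sigma> i"
      using permutation_in_support[OF nonneg \<open>0 < s\<close> rows cols] by blast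
    define m where "m = Min (range (\<lambda>i. B $ i $ \<sigma> i))"
    have m_le: "m \<le> B $ i $ \<sigma> i" for i by (simp add: m_def)
    have "m \<in> range (\<lambda>i. B $ i $ \<sigma> i)" unfolding m_def by (rule Min_in) auto
    then obtain k where k: "m = B $ k $ \<sigma> k" by blast
    have "0 < m" using \<sigma>(2) k by simp
    define B' :: "real ^ 'n ^ 'n" where "B' = (\<chi> i j. B $ i $ j - (if j = \<sigma> i then m else 0))"
    have B': "B' $ i $ j = B $ i $ j - (if j = \<sigma> i then m else 0)" for i j
      by (simp add: B'_def)
    have inv: "(j = \<sigma> i) = (i = inv \<sigma> j)" for i j
      using permutes_inv_eq[OF \<sigma>(1), of j i] by auto
    have nonneg': "0 \<le> B' $ i $ j" for i j using nonneg m_le by (auto simp: B')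
    have rows': "(\<Sum>j\<in>UNIV. B' $ i $ j) = s - m" for i
      by (simp add: B' sum_subtractf rows)
    have cols': "(\<Sum>i\<in>UNIV. B' $ i $ j) = s - m" for j
      by (simp add: B' sum_subtractf cols inv)
    have "(k, \<sigma> k) \<in> {(i, j). 0 < B $ i $ j} - {(i, j). 0 < B' $ i $ j}"
      using \<sigma>(2) k by (simp add: B')
    moreover have "{(i, j). 0 < B' $ i $ j} \<subseteq> {(i, j). 0 < B $ i $ j}"
      using \<open>0 < m\<close> by (auto simp: B' split: if_splits)
    ultimately have "card {(i, j). 0 < B' $ i $ j} < card {(i, j). 0 < B $ i $ j}"
      by (intro psubset_card_mono) auto
    then have IH: "(\<Sum>i\<in>UNIV. \<Sum>j\<in>UNIV. C $ i $ j * B' $ i $ j) \<le> (s - m) * maxTrace C"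
      using less.hyps nonneg' rows' cols' by blast
    have "C $ i $ j * B $ i $ j = C $ i $ j * B' $ i $ j + (if j = \<sigma> i then m * C $ i $ j else 0)"
      for i j by (simp add: B' algebra_simps)
    then have "(\<Sum>i\<in>UNIV. \<Sum>j\<in>UNIV. C $ i $ j * B $ i $ j) =
        (\<Sum>i\<in>UNIV. \<Sum>j\<in>UNIV. C $ i $ j * B' $ i $ j) + m * (\<Sum>i\<in>UNIV. C $ i $ \<sigma> i)"
      by (simp add: sum.distrib sum_distrib_left)
    also have "\<dots> \<le> (s - m) * maxTrace C + m * maxTrace C"
      using IH permutation_trace_le_maxTrace[OF \<sigma>(1)] \<open>0 < m\<close>
      by (intro add_mono mult_left_mono) auto
    finally show ?thesis by (simp add: algebra_simps)
  qed
qed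

section \<open>Orthogonality to the feasible directions\<close>

text \<open>
  The support condition is what makes \<open>A + t X\<close> bistochastic for small \<open>t > 0\<close>: only the positive
  entries of \<open>A\<close> move. Since \<open>A\<close> attains the bound \<open>inner_le_maxTrace\<close>, no such move can
  increase the inner product with \<open>A\<close>.
\<close>

lemma Erdos_matrix_inner_nonpos:
  fixes A X :: "real ^ 'n ^ 'n"
  assumes "Erdos_matrix A"
    and rowsX: "\<And>i. (\<Sum>j\<in>UNIV. X $ i $ j) = 0" and colsX: "\<And>j. (\<Sum>i\<in>UNIV. X $ i $ j) = 0"
    and supp: "\<And>i j. A $ i $ j = 0 \<Longrightarrow> X $ i $ j = 0"
  shows "(\<Sum>i\<in>UNIV. \<Sum>j\<in>UNIV. A $ i $ j * X $ i $ j) \<le> 0"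
proof -
  have nonneg: "\<And>i j. 0 \<le> A $ i $ j"
    and rows: "\<And>i. (\<Sum>j\<in>UNIV. A $ i $ j) = 1" and cols: "\<And>j. (\<Sum>i\<in>UNIV. A $ i $ j) = 1"
    and frob: "(\<Sum>i\<in>UNIV. \<Sum>j\<in>UNIV. A $ i $ j * A $ i $ j) = maxTrace A"
    using assms(1) by (auto simp: Erdos_matrix_def bistochastic_def frobenius_sq_def power2_eq_square)
  have "\<forall>\<^sub>F t in at_right 0. 0 \<le> A $ i $ j + t * X $ i $ j" for i j
  proof (cases "A $ i $ j = 0")
    case True
    then show ?thesis using supp by simp
  next
    case False
    have "((\<lambda>t. A $ i $ j + t * X $ i $ j) \<longlongrightarrow> A $ i $ j + 0 * X $ i $ j) (at_right 0)"
      by (intro tendsto_intros)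
    moreover have "0 < A $ i $ j + 0 * X $ i $ j" using False nonneg[of i j] by simp
    ultimately have "\<forall>\<^sub>F t in at_right 0. 0 < A $ i $ j + t * X $ i $ j"
      by (rule order_tendstoD)
    then show ?thesis by (rule eventually_mono) simp
  qed
  then have "\<forall>\<^sub>F t in at_right 0. \<forall>i j. 0 \<le> A $ i $ j + t * X $ i $ j"
    by (intro eventually_all_finite)
  moreover have "\<forall>\<^sub>F t in at_right (0::real). 0 < t"
    by (simp add: eventually_at_right_less)
  ultimately have "\<forall>\<^sub>F t in at_right 0. 0 < t \<and> (\<forall>i j. 0 \<le> A $ i $ j + t * X $ i $ j)"
    by eventually_elim simp
  then obtain t where t: "0 < t" "\<And>i j. 0 \<le> A $ i $ j + t * X $ i $ j"
    using eventually_happens'[OF trivial_limit_at_right_real] by blast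
  define B where "B = (\<chi> i j. A $ i $ j + t * X $ i $ j)"
  have "(\<Sum>i\<in>UNIV. \<Sum>j\<in>UNIV. A $ i $ j * B $ i $ j) \<le> 1 * maxTrace A"
    using t(2)
    by (intro inner_le_maxTrace)
      (simp_all add: B_def sum.distrib rows cols rowsX colsX flip: sum_distrib_left)
  moreover have "(\<Sum>i\<in>UNIV. \<Sum>j\<in>UNIV. A $ i $ j * B $ i $ j) =
      maxTrace A + t * (\<Sum>i\<in>UNIV. \<Sum>j\<in>UNIV. A $ i $ j * X $ i $ j)"
    by (simp add: B_def algebra_simps sum.distrib sum_distrib_left flip: frob)
  ultimately show ?thesis using t(1) by (simp add: mult_le_0_iff)
qed

lemma Erdos_matrix_orthogonal:
  fixes A X :: "real ^ 'n ^ 'n"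
  assumes "Erdos_matrix A"
    and "\<And>i. (\<Sum>j\<in>UNIV. X $ i $ j) = 0" and "\<And>j. (\<Sum>i\<in>UNIV. X $ i $ j) = 0"
    and "\<And>i j. A $ i $ j = 0 \<Longrightarrow> X $ i $ j = 0"
  shows "(\<Sum>i\<in>UNIV. \<Sum>j\<in>UNIV. A $ i $ j * X $ i $ j) = 0"
  using Erdos_matrix_inner_nonpos[OF assms] Erdos_matrix_inner_nonpos[of A "- X"] assms
  by (simp add: sum_negf)

section \<open>Rationality of the entries\<close>

lemma rat_linear_functional_separating_irrational:
  fixes a :: real
  assumes "a \<notin> \<rat>"
  obtains g :: "real \<Rightarrow> rat"
  where "\<And>x y. g (x + y) = g x + g y" "\<And>q x. g (of_rat q * x) = q * g x" "g 1 = 0" "g a = 1"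
proof -
  interpret vector_space_pair "\<lambda>(q::rat) (x::real). of_rat q * x" "(*) :: rat \<Rightarrow> rat \<Rightarrow> rat"
    by unfold_locales (auto simp: algebra_simps of_rat_add of_rat_mult)
  have "a \<notin> vs1.span {1}"
    using assms by (auto simp: vs1.span_singleton)
  then have "vs1.independent {a, 1}"
    by (intro vs1.independent_insertI) (auto simp: vs1.independent_insert vs1.independent_empty)
  then obtain g where g: "Vector_Spaces.linear (\<lambda>(q::rat) (x::real). of_rat q * x) (*) g"
    "\<forall>x\<in>{a, 1}. g x = (if x = a then 1 else 0)"
    using linear_independent_extend[of "{a, 1}" "\<lambda>x. if x = a then 1 else 0"] by blast
  moreover have "a \<noteq> 1" using assms by auto
  ultimately show ?thesis using that[of g] by (auto simp: Vector_Spaces.linear_iff)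
qed

theorem theorem1p6:
  fixes A :: "real ^ 'n ^ 'n"
  assumes "Erdos_matrix A"
  shows "\<forall>i j. A $ i $ j \<in> \<rat>"
proof (intro allI, rule ccontr)
  fix k l assume "A $ k $ l \<notin> \<rat>"
  then obtain g :: "real \<Rightarrow> rat" where add: "\<And>x y. g (x + y) = g x + g y"
    and scale: "\<And>q x. g (of_rat q * x) = q * g x" and "g 1 = 0" and kl: "g (A $ k $ l) = 1"
    using rat_linear_functional_separating_irrational by metis
  have "g 0 = 0" using add[of 0 0] by simp
  have g_sum: "g (\<Sum>i\<in>UNIV. h i) = (\<Sum>i\<in>UNIV. g (h i))" for h :: "'n \<Rightarrow> real"
    using sum_comp_morphism[of g h UNIV] \<open>g 0 = 0\<close> add by (simp add: comp_def)
  define X :: "real ^ 'n ^ 'n" where "X = (\<chi> i j. of_rat (g (A $ i $ j)))"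
  have "(\<Sum>i\<in>UNIV. \<Sum>j\<in>UNIV. A $ i $ j * X $ i $ j) = 0"
  proof (rule Erdos_matrix_orthogonal[OF assms])
    have rows: "(\<Sum>j\<in>UNIV. A $ i $ j) = 1" and cols: "(\<Sum>j\<in>UNIV. A $ j $ i) = 1" for i
      using assms by (auto simp: Erdos_matrix_def bistochastic_def)
    show "(\<Sum>j\<in>UNIV. X $ i $ j) = 0" "(\<Sum>j\<in>UNIV. X $ j $ i) = 0" for i
      using g_sum[of "\<lambda>j. A $ i $ j"] g_sum[of "\<lambda>j. A $ j $ i"] \<open>g 1 = 0\<close>
      by (simp_all add: X_def rows cols flip: of_rat_sum)
    show "X $ i $ j = 0" if "A $ i $ j = 0" for i j
      using that \<open>g 0 = 0\<close> by (simp add: X_def)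
  qed
  \<comment> \<open>The second factor \<open>X\<close> is rational, so it acts as a scalar when \<open>g\<close> is applied.\<close>
  then have "g (\<Sum>i\<in>UNIV. \<Sum>j\<in>UNIV. of_rat (g (A $ i $ j)) * A $ i $ j) = 0"
    using \<open>g 0 = 0\<close> by (simp add: X_def mult.commute)
  then have "(\<Sum>i\<in>UNIV. \<Sum>j\<in>UNIV. g (A $ i $ j) * g (A $ i $ j)) = 0"
    by (simp add: g_sum scale)
  then have "g (A $ k $ l) = 0"
    by (simp add: sum_nonneg_eq_0_iff sum_nonneg)
  then show False using kl by simp
qed

end
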